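(* Every pinwheel covering instance $(a_1,\dots,a_n)$ of positive integers with $\sum_{j=1}^n \frac{1}{a_j}\geq 1.3$ is schedulable.
   Context: A pinwheel covering instance is a finite list $(a_1,\dots,a_n)$ of positive integers. A schedule $f:\mathbb{N}\to\{1,\dots,n\}$ assigns each day to exactly one job. It is valid if for every $i$, every block of $a_i$ consecutive days contains at most one day assigned to job $i$. The instance is schedulable if a valid schedule exists. *)

theory Defs
  imports Complex_Main
begin

text \<open>
  Jobs are the positions \<open>0, \<dots>, length a - 1\<close> of the list (shifted by one from
  \<open>1, \<dots>, n\<close>), so equal entries are distinct jobs.
\<close>

definition covering_instance :: "nat list \<Rightarrow> bool" where
  "covering_instance a \<longleftrightarrow> (\<forall>x \<in> set a. 0 < x)"

definition valid_schedule :: "nat list \<Rightarrow> (nat \<Rightarrow> nat) \<Rightarrow> bool" where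
  "valid_schedule a f \<longleftrightarrow>
     (\<forall>t. f t < length a) \<and>
     (\<forall>i < length a. \<forall>s. card {t \<in> {s..<s + a ! i}. f t = i} \<le> 1)"

definition schedulable :: "nat list \<Rightarrow> bool" where
  "schedulable a \<longleftrightarrow> (\<exists>f. valid_schedule a f)"

end

theory Submission
  imports Defs "HOL-Combinatorics.Permutations" "HOL-Library.Code_Binary_Nat"
begin

text \<open>
  Repeat a word of length \<open>d\<close> over some of the short periods, with \<open>h\<close> letters left open. An open
  letter is a residue class modulo \<open>d\<close>, on which a job of period \<open>b\<close> acts with period
  \<open>\<lceil>b / d\<rceil>\<close>. Round these up to numbers of the form \<open>2 ^ e\<close> or \<open>3 * 2 ^ e\<close>; then total
  density \<open>h + 1 / 4\<close> suffices to fill all \<open>h\<close> classes. If this fails for several words, then a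
  nonnegative combination of the failed inequalities bounds the density of the long periods, as in
  linear programming duality. Branching on whether the smallest period not yet considered occurs, 55
  such combinations refute every instance of density at least 13/10 without period 1.
\<close>

section \<open>Schedules over an arbitrary set of jobs\<close>

definition covers :: "('j \<Rightarrow> nat) \<Rightarrow> 'j set \<Rightarrow> bool" where
  "covers p I \<longleftrightarrow>
     (\<exists>f. (\<forall>t. f t \<in> I) \<and> (\<forall>s t. s < t \<and> t < s + p (f s) \<longrightarrow> f t \<noteq> f s))"

lemma covers_imp_schedulable:
  assumes "covers ((!) a) {..<length a}"
  shows "schedulable a"
proof -
  obtain f where f: "\<And>t. f t < length a"
      "\<And>s t. s < t \<Longrightarrow> t < s + a ! (f s) \<Longrightarrow> f t \<noteq> f s"
    using assms unfolding covers_def by auto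
  have "card {t \<in> {s..<s + a ! i}. f t = i} \<le> 1" for i s
  proof -
    have "u = v" if "u \<in> {s..<s + a ! i}" "v \<in> {s..<s + a ! i}" "f u = i" "f v = i" for u v
    proof (cases u v rule: linorder_cases)
      case less
      then show ?thesis using f(2)[of u v] that by auto
    next
      case greater
      then show ?thesis using f(2)[of v u] that by auto
    qed
    then show ?thesis
      by (auto simp: card_le_Suc0_iff_eq)
  qed
  then show ?thesis
    unfolding schedulable_def valid_schedule_def using f(1) by blast
qed

lemma covers_image:
  assumes "covers p I" "inj_on \<phi> I" "\<phi> ` I \<subseteq> J" "\<And>i. i \<in> I \<Longrightarrow> q (\<phi> i) \<le> p i"
  shows "covers q J"
proof -
  obtain f where f: "\<And>t. f t \<in> I" "\<And>s t. s < t \<Longrightarrow> t < s + p (f s) \<Longrightarrow> f t \<noteq> f s"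
    using assms(1) unfolding covers_def by auto
  have "\<phi> (f t) \<noteq> \<phi> (f s)" if "s < t" "t < s + q (\<phi> (f s))" for s t
    using f(2)[of s t] that assms(4)[OF f(1)[of s]] inj_onD[OF assms(2) _ f(1) f(1)] by fastforce
  moreover have "\<phi> (f t) \<in> J" for t
    using f(1) assms(3) by blast
  ultimately show ?thesis
    unfolding covers_def by (intro exI[of _ "\<phi> \<circ> f"]) auto
qed

lemma covers_mono:
  assumes "covers p I" "I \<subseteq> J" "\<And>i. i \<in> I \<Longrightarrow> q i \<le> p i"
  shows "covers q J"
  using covers_image[of p I "\<lambda>i. i" J q] assms by auto

lemma covers_single:
  assumes "i \<in> I" "p i \<le> 1"
  shows "covers p I"
  unfolding covers_def using assms by (intro exI[of _ "\<lambda>_. i"]) auto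

text \<open>For the branching, which moves an entry of an instance to its front.\<close>

lemma covers_perm:
  assumes "covers ((!) a) {..<length a}" "mset a = mset b"
  shows "covers ((!) b) {..<length b}"
proof -
  obtain \<pi> where \<pi>: "\<pi> permutes {..<length b}" "permute_list \<pi> b = a"
    using mset_eq_permutation[OF assms(2)] by blast
  have len: "length a = length b"
    using assms(2) by (metis size_mset)
  show ?thesis
  proof (rule covers_image[OF assms(1)])
    show "inj_on \<pi> {..<length a}"
      using \<pi>(1) by (meson permutes_inj inj_on_subset subset_UNIV)
    show "\<pi> ` {..<length a} \<subseteq> {..<length b}"
      using permutes_image[OF \<pi>(1)] len by simp
    show "b ! \<pi> i \<le> a ! i" if "i \<in> {..<length a}" for i
      using permute_list_nth[OF \<pi>(1), of i] that \<pi>(2) len by simp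
  qed
qed

section \<open>Periodic words with open residue classes\<close>

text \<open>Days of one class modulo \<open>d\<close> are \<open>d\<close> apart, so a gap of
  \<open>q i\<close> in the schedule of a hole becomes a gap of \<open>d * q i\<close>, at least
  \<open>p i\<close>, in the whole schedule. Disjointness of the groups from each other and from the
  letters excludes every conflict between two holes or between a hole and a letter.\<close>

lemma covers_word:
  fixes w :: "nat \<Rightarrow> 'j option"
  assumes d: "0 < d"
    and jobs: "\<And>r i. r < d \<Longrightarrow> w r = Some i \<Longrightarrow> i \<in> I"
    and gap: "\<And>s t i. s < t \<Longrightarrow> t < s + p i \<Longrightarrow> w (s mod d) = Some i \<Longrightarrow> w (t mod d) \<noteq> Some i"
    and holes: "\<And>r. r < d \<Longrightarrow> w r = None \<Longrightarrow> covers q (G r) \<and> G r \<subseteq> I"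
    and scale: "\<And>r i. r < d \<Longrightarrow> w r = None \<Longrightarrow> i \<in> G r \<Longrightarrow> p i \<le> d * q i"
    and disj: "\<And>r s. r < d \<Longrightarrow> s < d \<Longrightarrow> w r = None \<Longrightarrow> w s = None \<Longrightarrow> r \<noteq> s \<Longrightarrow>
      G r \<inter> G s = {}"
    and sep: "\<And>r s i. r < d \<Longrightarrow> s < d \<Longrightarrow> w r = None \<Longrightarrow> w s = Some i \<Longrightarrow> i \<notin> G r"
  shows "covers p I"
proof -
  have "\<forall>r. \<exists>g. r < d \<and> w r = None \<longrightarrow> (\<forall>t. g t \<in> G r) \<and>
      (\<forall>s t. s < t \<and> t < s + q (g s) \<longrightarrow> g t \<noteq> g s)"
    using holes unfolding covers_def by blast
  then obtain g where g: "\<And>r t. r < d \<Longrightarrow> w r = None \<Longrightarrow> g r t \<in> G r"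
      "\<And>r s t. r < d \<Longrightarrow> w r = None \<Longrightarrow> s < t \<Longrightarrow> t < s + q (g r s) \<Longrightarrow> g r t \<noteq> g r s"
    by metis
  \<comment> \<open>The schedule of a hole advances by one day per round of the word.\<close>
  define f where "f t = (case w (t mod d) of Some i \<Rightarrow> i | None \<Rightarrow> g (t mod d) (t div d))" for t
  have md: "t mod d < d" for t
    using d by simp
  have "f t \<in> I" for t
  proof (cases "w (t mod d)")
    case None
    then show ?thesis using holes[OF md None] g(1)[OF md None] by (auto simp: f_def)
  qed (simp add: f_def jobs[OF md])
  moreover have "f t \<noteq> f s" if st: "s < t" "t < s + p (f s)" for s t
  proof
    assume eq: "f t = f s"
    show False
    proof (cases "w (s mod d)")
      case (Some i)
      then have fs: "f s = i"
        by (simp add: f_def)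
      show ?thesis
      proof (cases "w (t mod d)")
        case None
        then have "i \<in> G (t mod d)"
          using eq fs g(1)[OF md None, of "t div d"] None by (simp add: f_def)
        then show ?thesis using sep[OF md md None Some] by blast
      next
        case (Some j)
        then show ?thesis
          using eq fs gap[OF st(1), of i] st(2) \<open>w (s mod d) = Some i\<close> by (simp add: f_def)
      qed
    next
      case None
      then have fs: "f s = g (s mod d) (s div d)" "f s \<in> G (s mod d)"
        using g(1)[OF md None] by (simp_all add: f_def)
      have None': "w (t mod d) = None"
        using sep[OF md md None] eq fs(2) by (cases "w (t mod d)") (auto simp: f_def)
      then have ft: "f t = g (t mod d) (t div d)" "f t \<in> G (t mod d)"
        using g(1)[OF md None'] by (simp_all add: f_def)
      \<comment> \<open>Two holes that use the same job coincide, since otherwise their groups would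
        be disjoint.\<close>
      have r: "t mod d = s mod d"
        using disj[OF md md None None'] fs(2) ft(2) eq by (metis disjoint_iff)
      define S T where "S = s div d" and "T = t div d"
      have s: "s = d * S + s mod d" and t: "t = d * T + s mod d"
        unfolding S_def T_def using r mult_div_mod_eq[of d t] by simp_all
      have "S < T"
        using st(1) s t d by (metis add_less_cancel_right mult_less_cancel1)
      then have "\<not> T < S + q (f s)"
        using g(2)[OF md None, of S T] fs ft eq r unfolding S_def T_def by auto
      then have "d * (S + q (f s)) \<le> d * T"
        by simp
      then have "s + d * q (f s) \<le> t"
        using s t by (simp add: algebra_simps)
      then show ?thesis
        using scale[OF md None fs(2)] st(2) by simp
    qed
  qed
  ultimately show ?thesis
    unfolding covers_def by blast
qed

text \<open>The word made of holes only. It serves with \<open>d = 2\<close> to split a factor 2 off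
  the periods and with \<open>d = 3\<close> to split off a factor 3.\<close>

lemma covers_interleave:
  assumes "0 < d" "\<And>r. r < d \<Longrightarrow> covers q (G r)" "\<And>r. r < d \<Longrightarrow> G r \<subseteq> I"
    "disjoint_family_on G {..<d}" "\<And>i. i \<in> I \<Longrightarrow> p i \<le> d * q i"
  shows "covers p I"
proof (rule covers_word[where w = "\<lambda>_. None" and d = d and q = q and G = G])
  show "p i \<le> d * q i" if "r < d" "i \<in> G r" for r i
    using that assms(3,5) by blast
  show "G r \<inter> G s = {}" if "r < d" "s < d" "r \<noteq> s" for r s
    using that assms(4) by (auto simp: disjoint_family_on_def)
qed (use assms in auto)

section \<open>Periods that are powers of two\<close>

text \<open>An inclusion-minimal subset of sum at least \<open>h\<close> has sum exactly \<open>h\<close>, because the sum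
  and \<open>h\<close> are both multiples of its smallest summand.\<close>

lemma dyadic_subset:
  fixes e :: "'j \<Rightarrow> nat"
  assumes "finite I" "real h \<le> (\<Sum>i\<in>I. 1 / 2 ^ e i)"
  shows "\<exists>A\<subseteq>I. (\<Sum>i\<in>A. 1 / 2 ^ e i) = real h"
proof -
  let ?S = "\<lambda>A. \<Sum>i\<in>A. 1 / 2 ^ e i :: real"
  obtain A where A: "A \<subseteq> I" "real h \<le> ?S A"
    and least: "\<And>B. B \<subseteq> I \<Longrightarrow> real h \<le> ?S B \<Longrightarrow> card A \<le> card B"
    using ex_has_least_nat[of "\<lambda>A. A \<subseteq> I \<and> real h \<le> ?S A" I card] assms(2) by blast
  have fin: "finite A"
    using A(1) assms(1) finite_subset by blast
  have "?S A = real h"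
  proof (rule ccontr)
    assume ne: "?S A \<noteq> real h"
    then have gt: "real h < ?S A"
      using A(2) by simp
    then have "A \<noteq> {}"
      by auto
    then have "Max (e ` A) \<in> e ` A"
      using fin by simp
    then obtain j where j: "j \<in> A" "e j = Max (e ` A)"
      by auto
    have le: "e i \<le> e j" if "i \<in> A" for i
      using that fin j(2) by simp
    define n where "n = (\<Sum>i\<in>A. 2 ^ (e j - e i) :: nat)"
    have n: "?S A * 2 ^ e j = real n"
      unfolding n_def sum_distrib_right of_nat_sum
      by (rule sum.cong) (use le in \<open>simp_all add: power_diff[of "2::real"]\<close>)
    have "real h * 2 ^ e j < real n"
      using gt n by (metis mult_strict_right_mono zero_less_numeral zero_less_power)
    then have "real (h * 2 ^ e j) < real n"
      by simp
    then have "h * 2 ^ e j + 1 \<le> n"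
      by linarith
    then have "real (h * 2 ^ e j + 1) \<le> real n"
      by (rule of_nat_mono)
    then have "real h * 2 ^ e j + 1 \<le> ?S A * 2 ^ e j"
      using n by simp
    then have "real h \<le> ?S A - 1 / 2 ^ e j"
      by (simp add: field_simps)
    also have "\<dots> = ?S (A - {j})"
      using fin j(1) by (simp add: sum_diff1)
    finally have "card A \<le> card (A - {j})"
      using A(1) by (intro least) auto
    then show False
      using fin j(1) by (metis card_Diff1_less not_less)
  qed
  then show ?thesis using A(1) by blast
qed

text \<open>A subset of sum exactly 1 is split off; the rest then loses exactly 1, so nothing is
  wasted and induction on \<open>h\<close> applies.\<close>

lemma dyadic_groups:
  fixes e :: "'j \<Rightarrow> nat"
  assumes "finite I" "real h \<le> (\<Sum>i\<in>I. 1 / 2 ^ e i)"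
  shows "\<exists>G. (\<forall>k<h. G k \<subseteq> I \<and> (\<Sum>i\<in>G k. 1 / 2 ^ e i) = (1::real)) \<and>
    disjoint_family_on G {..<h}"
  using assms
proof (induction h arbitrary: I)
  case 0
  then show ?case by (simp add: disjoint_family_on_def)
next
  case (Suc h)
  obtain A where A: "A \<subseteq> I" "(\<Sum>i\<in>A. 1 / 2 ^ e i) = (1::real)"
    using dyadic_subset[of I 1 e] Suc.prems by auto
  have "(\<Sum>i\<in>I - A. 1 / 2 ^ e i) = (\<Sum>i\<in>I. 1 / 2 ^ e i) - (1::real)"
    using Suc.prems(1) A by (simp add: sum_diff)
  then obtain G where G: "\<And>k. k < h \<Longrightarrow> G k \<subseteq> I - A"
      "\<And>k. k < h \<Longrightarrow> (\<Sum>i\<in>G k. 1 / 2 ^ e i) = (1::real)" "disjoint_family_on G {..<h}"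
    using Suc.IH[of "I - A"] Suc.prems by auto
  show ?case
  proof (intro exI[of _ "G(h := A)"] conjI allI impI)
    show "disjoint_family_on (G(h := A)) {..<Suc h}"
      using G(1,3) unfolding disjoint_family_on_def by (auto simp: less_Suc_eq) blast+
  qed (use G A in \<open>auto simp: less_Suc_eq\<close>)
qed

text \<open>A job of period 1 suffices alone. Otherwise all periods are even; halving them doubles
  the density to at least 2, which yields two disjoint groups of density 1, one for the even and one
  for the odd days.\<close>

lemma dyadic_covers:
  fixes e :: "'j \<Rightarrow> nat"
  assumes "finite I" "1 \<le> (\<Sum>i\<in>I. 1 / 2 ^ e i :: real)"
  shows "covers (\<lambda>i. 2 ^ e i) I"
proof -
  \<comment> \<open>Halving lowers every exponent, so the induction is on a bound for the exponents,
    with \<open>e\<close> and \<open>I\<close> arbitrary.\<close>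
  have bounded: "covers (\<lambda>i. 2 ^ e i) I"
    if "\<And>i. i \<in> I \<Longrightarrow> e i \<le> n" "finite I" "1 \<le> (\<Sum>i\<in>I. 1 / 2 ^ e i :: real)" for n e and I :: "'j set"
    using that
  proof (induction n arbitrary: e I)
    case 0
    then have "I \<noteq> {}"
      by auto
    then show ?case using 0 by (auto intro: covers_single)
  next
    case (Suc n)
    show ?case
    proof (cases "\<exists>i\<in>I. e i = 0")
      case True
      then show ?thesis by (auto intro: covers_single)
    next
      case False
      have half: "(2::nat) ^ e i = 2 * 2 ^ (e i - 1)" if "i \<in> I" for i
        using False that by (cases "e i") auto
      have "(\<Sum>i\<in>I. 1 / 2 ^ (e i - 1) :: real) = 2 * (\<Sum>i\<in>I. 1 / 2 ^ e i)"
        unfolding sum_distrib_left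
      proof (rule sum.cong)
        show "1 / 2 ^ (e i - 1) = 2 * (1 / 2 ^ e i :: real)" if "i \<in> I" for i
          using False that by (cases "e i") auto
      qed simp
      then have "real 2 \<le> (\<Sum>i\<in>I. 1 / 2 ^ (e i - 1))"
        using Suc.prems(3) by simp
      then obtain G where G: "\<And>k::nat. k < 2 \<Longrightarrow> G k \<subseteq> I"
          "\<And>k::nat. k < 2 \<Longrightarrow> (\<Sum>i\<in>G k. 1 / 2 ^ (e i - 1)) = (1::real)" "disjoint_family_on G {..<2}"
        using dyadic_groups[OF Suc.prems(2), of 2 "\<lambda>i. e i - 1"] by blast
      show ?thesis
      proof (rule covers_interleave[where d = 2 and q = "\<lambda>i. 2 ^ (e i - 1)" and G = G])
        show "covers (\<lambda>i. 2 ^ (e i - 1)) (G k)" if "k < 2" for k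
        proof (rule Suc.IH)
          show "e i - 1 \<le> n" if "i \<in> G k" for i
            using Suc.prems(1)[of i] G(1)[OF \<open>k < 2\<close>] that by fastforce
          show "finite (G k)"
            using G(1)[OF \<open>k < 2\<close>] Suc.prems(2) finite_subset by blast
          show "1 \<le> (\<Sum>i\<in>G k. 1 / 2 ^ (e i - 1) :: real)"
            using G(2)[OF \<open>k < 2\<close>] by simp
        qed
        show "disjoint_family_on G {..<2}"
          by (rule G(3))
        show "2 ^ e i \<le> 2 * (2::nat) ^ (e i - 1)" if "i \<in> I" for i
          using half[OF that] by simp
        show "G k \<subseteq> I" if "k < 2" for k
          by (rule G(1)[OF that])
      qed simp
    qed
  qed
  show ?thesis
    by (rule bounded[where n = "Max (e ` I)"]) (use assms in simp_all)
qed

section \<open>Periods with an additional factor 3\<close>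

text \<open>As many of the periods \<open>3 * 2 ^ e\<close> as possible are put into groups of density exactly 1; the
  remaining ones have density less than 1, so that rounding them up to \<open>4 * 2 ^ e\<close> costs less
  than \<open>1 / 4\<close>, and then only powers of two are left.\<close>

lemma mixed_groups:
  fixes n :: "'j \<Rightarrow> nat"
  assumes fin: "finite I" and nice: "\<And>i. i \<in> I \<Longrightarrow> \<exists>e. n i = 2 ^ e \<or> n i = 3 * 2 ^ e"
    and sum: "real h + 1 / 4 \<le> (\<Sum>i\<in>I. 1 / real (n i))"
  shows "\<exists>G. (\<forall>k<h. G k \<subseteq> I \<and> covers n (G k)) \<and> disjoint_family_on G {..<h}"
proof -
  obtain e where e: "\<And>i. i \<in> I \<Longrightarrow> n i = 2 ^ e i \<or> n i = 3 * 2 ^ e i"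
    using nice by metis
  define I3 where "I3 = {i \<in> I. n i = 3 * 2 ^ e i}"
  define I2 where "I2 = I - I3"
  have fin': "finite I3" "finite I2" and I23: "I = I2 \<union> I3" "I2 \<inter> I3 = {}"
    using fin unfolding I2_def I3_def by auto
  have n3: "n i = 3 * 2 ^ e i" if "i \<in> I3" for i
    using that by (simp add: I3_def)
  have n2: "n i = 2 ^ e i" if "i \<in> I2" for i
    using that e[of i] by (auto simp: I2_def I3_def)
  \<comment> \<open>\<open>s\<close> is three times the density of \<open>I3\<close>, and
    \<open>m\<close> is the integer part of that density.\<close>
  define s where "s = (\<Sum>i\<in>I3. 1 / 2 ^ e i :: real)"
  define m where "m = nat \<lfloor>s / 3\<rfloor>"
  have "0 \<le> s"
    unfolding s_def by (simp add: sum_nonneg)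
  then have m: "real m \<le> s / 3" "s / 3 < real m + 1"
    unfolding m_def by linarith+
  obtain A where A: "A \<subseteq> I3" "(\<Sum>i\<in>A. 1 / 2 ^ e i) = real (3 * m)"
    using dyadic_subset[OF fin'(1), of "3 * m" e] m(1) unfolding s_def by auto
  have finA: "finite A"
    using A(1) fin'(1) finite_subset by blast
  obtain T where T: "\<And>k. k < 3 * m \<Longrightarrow> T k \<subseteq> A"
      "\<And>k. k < 3 * m \<Longrightarrow> (\<Sum>i\<in>T k. 1 / 2 ^ e i) = (1::real)" "disjoint_family_on T {..<3 * m}"
    using dyadic_groups[OF finA, of "3 * m" e] A(2) by auto
  define J where "J = I2 \<union> (I3 - A)"
  \<comment> \<open>The exponent \<open>e i + 2\<close> rounds \<open>3 * 2 ^ e i\<close> up to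
    \<open>4 * 2 ^ e i\<close>.\<close>
  define e' where "e' i = (if i \<in> I3 then e i + 2 else e i)" for i
  have "(\<Sum>i\<in>J. 1 / 2 ^ e' i) = (\<Sum>i\<in>I2. 1 / 2 ^ e i) + (\<Sum>i\<in>I3 - A. 1 / 2 ^ e i / (4::real))"
    unfolding J_def using fin' I23
    by (subst sum.union_disjoint) (auto simp: e'_def intro!: sum.cong arg_cong2[of _ _ _ _ "(+)"])
  also have "(\<Sum>i\<in>I3 - A. 1 / 2 ^ e i / (4::real)) = (s - 3 * m) / 4"
    using A fin'(1) unfolding sum_divide_distrib[symmetric] by (simp add: s_def sum_diff)
  also have "(\<Sum>i\<in>I2. 1 / 2 ^ e i) = (\<Sum>i\<in>I. 1 / real (n i)) - s / 3"
    unfolding I23(1) s_def sum_divide_distrib using fin' I23(2) n2 n3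
    by (subst sum.union_disjoint) (auto intro!: sum.cong)
  \<comment> \<open>The leftover \<open>s - 3 * m\<close> is below 3, so replacing
    \<open>(s - 3 * m) / 3\<close> by \<open>(s - 3 * m) / 4\<close> loses less than
    \<open>1 / 4\<close>.\<close>
  finally have "real h - real m \<le> (\<Sum>i\<in>J. 1 / 2 ^ e' i)"
    using sum m(2) by (simp add: field_simps)
  \<comment> \<open>This settles the case that \<open>m\<close> exceeds \<open>h\<close>, where the
    truncated difference \<open>h - m\<close> is 0.\<close>
  moreover have "0 \<le> (\<Sum>i\<in>J. 1 / 2 ^ e' i :: real)"
    by (simp add: sum_nonneg)
  ultimately have sumJ: "real (h - m) \<le> (\<Sum>i\<in>J. 1 / 2 ^ e' i)"
    by (cases "m \<le> h") (auto simp: of_nat_diff)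
  have finJ: "finite J"
    using fin' by (simp add: J_def)
  obtain L where L: "\<And>k. k < h - m \<Longrightarrow> L k \<subseteq> J"
      "\<And>k. k < h - m \<Longrightarrow> (\<Sum>i\<in>L k. 1 / 2 ^ e' i) = (1::real)" "disjoint_family_on L {..<h - m}"
    using dyadic_groups[OF finJ sumJ] by auto
  \<comment> \<open>Three groups of density 1 for the periods \<open>2 ^ e i\<close> interleave to
    one group for the periods \<open>3 * 2 ^ e i\<close>.\<close>
  define U where "U k = (\<Union>r<3. T (3 * k + r))" for k
  define G where "G k = (if k < m then U k else L (k - m))" for k
  have UA: "U k \<subseteq> A" if "k < m" for k
    unfolding U_def using that by (intro UN_least T(1)) auto
  have TT: "T k \<inter> T l = {}" if "k < 3 * m" "l < 3 * m" "k \<noteq> l" for k l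
    using T(3) that by (auto simp: disjoint_family_on_def)
  have Ucov: "covers n (U k)" if "k < m" for k
  proof (rule covers_interleave[where d = 3 and q = "\<lambda>i. 2 ^ e i" and G = "\<lambda>r. T (3 * k + r)"])
    fix r :: nat assume r: "r < 3"
    then have kr: "3 * k + r < 3 * m"
      using that by simp
    show "covers (\<lambda>i. 2 ^ e i) (T (3 * k + r))"
      using dyadic_covers[of "T (3 * k + r)" e] T(1,2)[OF kr] finA finite_subset by fastforce
    show "T (3 * k + r) \<subseteq> U k"
      unfolding U_def using r by blast
  next
    show "disjoint_family_on (\<lambda>r. T (3 * k + r)) {..<3}"
      unfolding disjoint_family_on_def
    proof (intro ballI impI)
      show "T (3 * k + r) \<inter> T (3 * k + r') = {}" if "r \<in> {..<3}" "r' \<in> {..<3}" "r \<noteq> r'" for r r'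
        using that \<open>k < m\<close> by (intro TT) auto
    qed
    show "n i \<le> 3 * 2 ^ e i" if "i \<in> U k" for i
      using n3[of i] UA[OF \<open>k < m\<close>] A(1) that by auto
  qed simp
  have Lcov: "covers n (L k)" if "k < h - m" for k
  proof (rule covers_mono)
    show "covers (\<lambda>i. 2 ^ e' i) (L k)"
      using dyadic_covers[of "L k" e'] L(1,2)[OF that] finJ finite_subset by fastforce
    show "n i \<le> 2 ^ e' i" if "i \<in> L k" for i
    proof -
      have "i \<in> J"
        using L(1) that \<open>k < h - m\<close> by blast
      then show ?thesis using n2[of i] n3[of i] by (auto simp: J_def e'_def)
    qed
  qed simp
  have AJ: "A \<inter> J = {}" "A \<subseteq> I" "J \<subseteq> I"
    using A(1) I23 unfolding J_def by auto
  have "G k \<inter> G l = {}" if kl: "k < h" "l < h" "k < l" for k l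
  proof -
    consider "l < m" | "k < m" "m \<le> l" | "m \<le> k"
      by linarith
    then show ?thesis
    proof cases
      case 1
      then have "T (3 * k + r) \<inter> T (3 * l + r') = {}" if "r < 3" "r' < 3" for r r'
        using kl that by (intro TT) linarith+
      then have "U k \<inter> U l = {}"
        unfolding U_def by blast
      then show ?thesis
        using 1 kl by (simp add: G_def)
    next
      case 2
      then have "U k \<subseteq> A" "L (l - m) \<subseteq> J"
        using UA[of k] L(1)[of "l - m"] kl by auto
      then show ?thesis
        using 2 AJ(1) by (auto simp: G_def)
    next
      case 3
      then have "k - m \<noteq> l - m" "k - m < h - m" "l - m < h - m"
        using kl by auto
      then show ?thesis
        using 3 kl L(3) by (auto simp: G_def disjoint_family_on_def)
    qed
  qed
  then have "disjoint_family_on G {..<h}"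
    unfolding disjoint_family_on_def by (metis inf_commute lessThan_iff linorder_neqE_nat)
  moreover have "G k \<subseteq> I \<and> covers n (G k)" if "k < h" for k
  proof (cases "k < m")
    case True
    then show ?thesis using UA[of k] Ucov AJ by (auto simp: G_def)
  next
    case False
    then have "k - m < h - m"
      using that by linarith
    then show ?thesis using False L(1)[of "k - m"] Lcov AJ by (auto simp: G_def)
  qed
  ultimately show ?thesis by blast
qed

section \<open>Rounding periods up\<close>

text \<open>The least number of the form \<open>2 ^ e\<close> or \<open>3 * 2 ^ e\<close> that is at
  least \<open>q\<close>. Such numbers above 3 are even, which justifies the halving. The value at 0
  is 1, so that all values are positive.\<close>

function nice :: "nat \<Rightarrow> nat" where
  "nice q = (if q \<le> 3 then max 1 q else 2 * nice ((q + 1) div 2))"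
  by auto
termination by (relation "measure id") auto

declare nice.simps [simp del]

lemma nice_ge: "q \<le> nice q"
proof (induction q rule: nice.induct)
  case (1 q)
  then show ?case by (subst nice.simps) auto
qed

lemma nice_pos: "0 < nice q"
  using nice_ge[of q] by (cases "q = 0") (auto simp: nice.simps[of 0])

lemma nice_form: "\<exists>e. nice q = 2 ^ e \<or> nice q = 3 * 2 ^ e"
proof (induction q rule: nice.induct)
  case (1 q)
  show ?case
  proof (cases "q \<le> 3")
    case True
    then have "nice q = 2 ^ 0 \<or> nice q = 2 ^ 1 \<or> nice q = 3 * 2 ^ 0"
      by (auto simp: nice.simps[of q])
    then show ?thesis by blast
  next
    case False
    then obtain e where "nice ((q + 1) div 2) = 2 ^ e \<or> nice ((q + 1) div 2) = 3 * 2 ^ e"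
      using 1 by blast
    then have "nice q = 2 ^ Suc e \<or> nice q = 3 * 2 ^ Suc e"
      using False by (auto simp: nice.simps[of q])
    then show ?thesis by blast
  qed
qed

lemma nice_mono: "q \<le> q' \<Longrightarrow> nice q \<le> nice q'"
proof (induction q' arbitrary: q rule: nice.induct)
  case (1 q')
  consider "q' \<le> 3" | "q \<le> 3" "3 < q'" | "3 < q" "3 < q'"
    by linarith
  then show ?case
  proof cases
    case 1
    then show ?thesis using \<open>q \<le> q'\<close> by (simp add: nice.simps[of q] nice.simps[of q'])
  next
    case 2
    then show ?thesis using nice_ge[of q'] by (simp add: nice.simps[of q])
  next
    case 3
    then have "nice ((q + 1) div 2) \<le> nice ((q' + 1) div 2)"
      using "1.IH" "1.prems" by (simp add: div_le_mono)
    then show ?thesis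
      using 3 by (simp add: nice.simps[of q] nice.simps[of q'])
  qed
qed

lemma nice_double: "nice (2 * x) \<le> 2 * nice x"
proof (cases "x \<le> 1")
  case True
  then show ?thesis by (auto simp: nice.simps[of x] nice.simps[of "2 * x"])
next
  case False
  then show ?thesis by (simp add: nice.simps[of "2 * x"])
qed

text \<open>The argument of \<open>nice\<close> is \<open>b / d\<close> rounded up: the period that
  a job of period \<open>b\<close> has within a residue class modulo \<open>d\<close>.\<close>

definition slot :: "nat \<Rightarrow> nat \<Rightarrow> nat" where
  "slot d b = nice ((b + d - 1) div d)"

lemma ceil_div_le_iff: "0 < d \<Longrightarrow> (b + d - 1) div d \<le> y \<longleftrightarrow> b \<le> d * y" for b d y :: nat
proof -
  assume d: "0 < d"
  have "(b + d - 1) div d \<le> y \<longleftrightarrow> (b + d - 1) div d < Suc y"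
    by auto
  also have "\<dots> \<longleftrightarrow> b + d - 1 < Suc y * d"
    using d by (simp add: div_less_iff_less_mult)
  also have "\<dots> \<longleftrightarrow> b \<le> d * y"
    using d by (auto simp: mult.commute)
  finally show ?thesis .
qed

lemma slot_pos: "0 < slot d b"
  by (simp add: slot_def nice_pos)

lemma le_slot: "0 < d \<Longrightarrow> b \<le> d * slot d b"
  by (metis ceil_div_le_iff nice_ge slot_def)

text \<open>If half of \<open>b\<close>, rounded up, is at most \<open>d * x\<close>, then
  \<open>b\<close> is at most \<open>d * (2 * x)\<close>. This lets finitely many weights control
  those of all larger periods.\<close>

lemma slot_double:
  assumes "0 < d"
  shows "slot d b \<le> 2 * slot d ((b + 1) div 2)"
proof -
  define x where "x = ((b + 1) div 2 + d - 1) div d"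
  have "(b + 1) div 2 \<le> d * x"
    unfolding x_def using ceil_div_le_iff[OF assms] by blast
  then have "b \<le> d * (2 * x)"
    by linarith
  then have "(b + d - 1) div d \<le> 2 * x"
    using ceil_div_le_iff[OF assms] by blast
  then show ?thesis
    unfolding slot_def x_def[symmetric] using nice_mono nice_double le_trans by blast
qed

section \<open>Words over the short periods\<close>

text \<open>A word over \<open>pre\<close> lists positions of \<open>pre\<close> to be repeated forever; entries beyond the
  length of \<open>pre\<close> are holes.\<close>

definition word_ok :: "nat list \<Rightarrow> nat list \<Rightarrow> bool" where
  "word_ok pre w \<longleftrightarrow> w \<noteq> [] \<and>
     list_all (\<lambda>r. w ! r < length pre \<longrightarrow>
       w ! r \<notin> set (take (pre ! (w ! r) - 1) (drop (r + 1) (w @ w)))) [0..<length w]"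

definition num_holes :: "nat list \<Rightarrow> nat list \<Rightarrow> nat" where
  "num_holes pre w = length (filter (\<lambda>k. length pre \<le> k) w)"

text \<open>Periods of the prefix that the word leaves out can still help to fill its holes.\<close>

definition idle :: "nat list \<Rightarrow> nat list \<Rightarrow> nat list" where
  "idle pre w = map ((!) pre) (filter (\<lambda>k. k \<notin> set w) [0..<length pre])"

text \<open>Two copies of \<open>w\<close> suffice: at a distance beyond the length of
  \<open>w\<close>, the period exceeds that length as well, and the test already fails at the
  recurrence of the same letter one round later.\<close>

lemma word_ok_gap:
  assumes ok: "word_ok pre w" and i: "w ! (s mod length w) = i" "i < length pre"
    and st: "s < t" "t < s + pre ! i"
  shows "w ! (t mod length w) \<noteq> i"
proof
  assume eq: "w ! (t mod length w) = i"
  let ?d = "length w"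
  define r where "r = s mod ?d"
  have d: "0 < ?d" and r: "r < ?d"
    using ok by (auto simp: word_ok_def r_def)
  have notin: "i \<notin> set (take (pre ! i - 1) (drop (r + 1) (w @ w)))"
    using ok r i unfolding word_ok_def list_all_iff r_def[symmetric]
    by (auto simp del: drop_append take_append set_append)
  have nth: "(w @ w) ! (r + j) = w ! ((s + j) mod ?d)" if "j \<le> ?d" for j
  proof -
    have "(s + j) mod ?d = (r + j) mod ?d"
      unfolding r_def by (simp add: mod_add_left_eq)
    also have "\<dots> = (if r + j < ?d then r + j else r + j - ?d)"
      using r that by (simp add: mod_if)
    finally show ?thesis
      by (simp add: nth_append)
  qed
  have later: "False" if j: "0 < j" "j \<le> ?d" "j < pre ! i" "w ! ((s + j) mod ?d) = i" for j
  proof -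
    have "take (pre ! i - 1) (drop (r + 1) (w @ w)) ! (j - 1) = (w @ w) ! (r + j)"
      using j r by (simp del: drop_append take_append)
    also have "\<dots> = i"
      using nth j by simp
    finally have "take (pre ! i - 1) (drop (r + 1) (w @ w)) ! (j - 1) = i" .
    moreover have "j - 1 < length (take (pre ! i - 1) (drop (r + 1) (w @ w)))"
      using j r by auto
    ultimately show False
      using notin nth_mem by metis
  qed
  show False
  proof (cases "t - s \<le> ?d")
    case True
    then show ?thesis using later[of "t - s"] st eq by simp linarith
  next
    case False
    then show ?thesis using later[of ?d] st i d by simp linarith
  qed
qed

text \<open>The jobs of \<open>rest\<close> and the idle jobs of the prefix are split by
  \<open>mixed_groups\<close> into one group per hole, and \<open>covers_word\<close> puts the
  groups into the holes.\<close>

lemma word_criterion: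
  fixes pre rest w :: "nat list"
  assumes ok: "word_ok pre w"
    and sum: "real (num_holes pre w) + 1 / 4 \<le>
      (\<Sum>b\<leftarrow>idle pre w @ rest. 1 / real (slot (length w) b))"
  shows "covers ((!) (pre @ rest)) {..<length (pre @ rest)}"
proof -
  define n d a where "n = length pre" and "d = length w" and "a = pre @ rest"
  have d: "0 < d"
    using ok by (auto simp: d_def word_ok_def)
  \<comment> \<open>The free jobs are collected as positions, since equal periods are distinct
    jobs.\<close>
  define I1 where "I1 = {k. k < n \<and> k \<notin> set w}"
  define I where "I = I1 \<union> {n..<length a}"
  have "(\<Sum>i\<in>I. 1 / real (slot d (a ! i))) =
      (\<Sum>i\<in>I1. 1 / real (slot d (a ! i))) + (\<Sum>i\<in>{n..<length a}. 1 / real (slot d (a ! i)))"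
    unfolding I_def I1_def by (rule sum.union_disjoint) auto
  also have "(\<Sum>i\<in>{n..<length a}. 1 / real (slot d (a ! i))) = (\<Sum>b\<leftarrow>rest. 1 / real (slot d b))"
  proof -
    have "(\<Sum>b\<leftarrow>rest. 1 / real (slot d b)) = (\<Sum>i\<in>{0..<length rest}. 1 / real (slot d (rest ! i)))"
      by (simp add: sum_list_sum_nth)
    also have "\<dots> = (\<Sum>i\<in>{0 + n..<length rest + n}. 1 / real (slot d (rest ! (i - n))))"
      by (subst sum.shift_bounds_nat_ivl) simp
    also have "\<dots> = (\<Sum>i\<in>{n..<length a}. 1 / real (slot d (a ! i)))"
      unfolding a_def n_def by (rule sum.cong) (auto simp: nth_append)
    finally show ?thesis by simp
  qed
  also have "(\<Sum>i\<in>I1. 1 / real (slot d (a ! i))) = (\<Sum>b\<leftarrow>idle pre w. 1 / real (slot d b))"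
  proof -
    have "(\<Sum>b\<leftarrow>idle pre w. 1 / real (slot d b)) =
        (\<Sum>k\<in>set (filter (\<lambda>k. k \<notin> set w) [0..<length pre]). 1 / real (slot d (pre ! k)))"
      unfolding idle_def map_map by (subst sum_list_distinct_conv_sum_set) (simp_all add: comp_def)
    also have "\<dots> = (\<Sum>i\<in>I1. 1 / real (slot d (a ! i)))"
      unfolding I1_def a_def n_def by (rule sum.cong) (auto simp: nth_append)
    finally show ?thesis by simp
  qed
  finally have "real (num_holes pre w) + 1 / 4 \<le> (\<Sum>i\<in>I. 1 / real (slot d (a ! i)))"
    using sum by (simp add: d_def)
  moreover have "finite I"
    unfolding I_def I1_def by simp
  moreover have "\<exists>e. slot d (a ! i) = 2 ^ e \<or> slot d (a ! i) = 3 * 2 ^ e" for i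
    unfolding slot_def by (rule nice_form)
  ultimately have "\<exists>G. (\<forall>k<num_holes pre w. G k \<subseteq> I \<and> covers (\<lambda>i. slot d (a ! i)) (G k)) \<and>
      disjoint_family_on G {..<num_holes pre w}"
    by (intro mixed_groups)
  then obtain G where G: "\<And>k. k < num_holes pre w \<Longrightarrow> G k \<subseteq> I"
      "\<And>k. k < num_holes pre w \<Longrightarrow> covers (\<lambda>i. slot d (a ! i)) (G k)"
      "disjoint_family_on G {..<num_holes pre w}"
    by blast
  \<comment> \<open>\<open>H\<close> is the set of positions of the holes; the bijection \<beta>
    numbers them, so that hole \<open>r\<close> receives the group
    \<open>G (\<beta> r)\<close>.\<close>
  define H where "H = {r. r < d \<and> n \<le> w ! r}"
  have "card H = num_holes pre w"
    unfolding H_def num_holes_def d_def n_def by (simp add: length_filter_conv_card)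
  then obtain \<beta> where \<beta>: "bij_betw \<beta> H {0..<num_holes pre w}"
    using ex_bij_betw_finite_nat[of H] unfolding H_def by auto
  have \<beta>H: "\<beta> r < num_holes pre w" if "r \<in> H" for r
    using bij_betwE[OF \<beta>] that by auto
  have "covers ((!) a) {..<length a}"
  proof (rule covers_word[where w = "\<lambda>r. if w ! r < n then Some (w ! r) else None" and d = d
        and q = "\<lambda>i. slot d (a ! i)" and G = "\<lambda>r. G (\<beta> r)"])
    fix r i
    assume r: "r < d" "(if w ! r < n then Some (w ! r) else None) = Some i"
    then show "i \<in> {..<length a}"
      by (auto simp: a_def n_def split: if_splits)
  next
    fix s t i
    assume st: "s < t" "t < s + a ! i"
      "(if w ! (s mod d) < n then Some (w ! (s mod d)) else None) = Some i"
    then have "w ! (s mod d) = i" "i < length pre" "t < s + pre ! i"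
      by (auto simp: n_def a_def nth_append split: if_splits)
    then have "w ! (t mod d) \<noteq> i"
      using word_ok_gap[OF ok] st(1) unfolding d_def by blast
    then show "(if w ! (t mod d) < n then Some (w ! (t mod d)) else None) \<noteq> Some i"
      by auto
  next
    fix r
    assume r: "r < d" "(if w ! r < n then Some (w ! r) else None) = None"
    then have "r \<in> H"
      by (auto simp: H_def split: if_splits)
    then show "covers (\<lambda>i. slot d (a ! i)) (G (\<beta> r)) \<and> G (\<beta> r) \<subseteq> {..<length a}"
      using G(1,2)[OF \<beta>H[OF \<open>r \<in> H\<close>]] by (fastforce simp: I_def I1_def a_def n_def)
  next
    fix r i
    show "a ! i \<le> d * slot d (a ! i)"
      by (rule le_slot[OF d])
  next
    fix r s
    assume rs: "r < d" "s < d" "(if w ! r < n then Some (w ! r) else None) = None"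
      "(if w ! s < n then Some (w ! s) else None) = None" "r \<noteq> s"
    then have "r \<in> H" "s \<in> H"
      by (auto simp: H_def split: if_splits)
    then have "\<beta> r \<noteq> \<beta> s"
      using \<beta> rs(5) by (metis bij_betw_imp_inj_on inj_onD)
    then show "G (\<beta> r) \<inter> G (\<beta> s) = {}"
      using G(3) \<beta>H \<open>r \<in> H\<close> \<open>s \<in> H\<close> by (auto simp: disjoint_family_on_def)
  next
    fix r s i
    assume rs: "r < d" "s < d" "(if w ! r < n then Some (w ! r) else None) = None"
      "(if w ! s < n then Some (w ! s) else None) = Some i"
    then have "r \<in> H" and i: "i < n" "i \<in> set w"
      by (auto simp: H_def d_def split: if_splits)
    then show "i \<notin> G (\<beta> r)"
      using G(1)[OF \<beta>H[OF \<open>r \<in> H\<close>]] by (auto simp: I_def I1_def)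
  qed (use d in simp)
  then show ?thesis
    by (simp add: a_def)
qed

section \<open>Branching and linear programming duality\<close>

text \<open>A node of the case distinction: \<open>pre\<close> holds the short periods known to
  occur, and \<open>rest\<close> is undetermined except for its lower bound
  \<open>b\<close>.\<close>

definition coverable :: "nat list \<Rightarrow> nat \<Rightarrow> bool" where
  "coverable pre b \<longleftrightarrow> (\<forall>rest. (\<forall>x\<in>set rest. b \<le> x) \<longrightarrow>
     13 / 10 \<le> (\<Sum>x\<leftarrow>pre @ rest. 1 / real x) \<longrightarrow>
     covers ((!) (pre @ rest)) {..<length (pre @ rest)})"

text \<open>Either one copy of \<open>b\<close> moves into the prefix, with the bound kept at
  \<open>b\<close> for further copies, or no copy is left and the bound rises.\<close>

lemma coverable_branch:
  assumes "coverable (b # pre) b" "coverable pre (Suc b)"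
  shows "coverable pre b"
  unfolding coverable_def
proof (intro allI impI)
  fix rest
  assume rest: "\<forall>x\<in>set rest. b \<le> x" and sum: "13 / 10 \<le> (\<Sum>x\<leftarrow>pre @ rest. 1 / real x)"
  show "covers ((!) (pre @ rest)) {..<length (pre @ rest)}"
  proof (cases "b \<in> set rest")
    case True
    let ?a = "(b # pre) @ remove1 b rest"
    have ms: "mset ?a = mset (pre @ rest)"
      using True by simp
    have "(\<Sum>x\<leftarrow>?a. 1 / real x) = (\<Sum>x\<in>#mset ?a. 1 / real x)"
      by (simp flip: sum_mset_sum_list)
    also have "\<dots> = (\<Sum>x\<leftarrow>pre @ rest. 1 / real x)"
      unfolding ms by (simp flip: sum_mset_sum_list)
    finally have "13 / 10 \<le> (\<Sum>x\<leftarrow>?a. 1 / real x)"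
      using sum by simp
    moreover have "\<forall>x\<in>set (remove1 b rest). b \<le> x"
      using rest notin_set_remove1 by metis
    ultimately have "covers ((!) ?a) {..<length ?a}"
      using assms(1) unfolding coverable_def by blast
    then show ?thesis
      using ms by (rule covers_perm)
  next
    case False
    then have "\<forall>x\<in>set rest. Suc b \<le> x"
      using rest by (metis Suc_leI le_neq_implies_less)
    then show ?thesis
      using assms(2) sum unfolding coverable_def by blast
  qed
qed

text \<open>Weak duality. If no schedule exists, every word fails \<open>word_criterion\<close>,
  which bounds the slot density of \<open>rest\<close> from above. The combination with multipliers
  \<open>m\<close> dominates \<open>N / x\<close> for each \<open>x\<close> in \<open>rest\<close>,
  so it bounds the density of \<open>rest\<close> below the amount that the prefix leaves missing
  from \<open>13 / 10\<close>.\<close>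

lemma coverable_weights:
  fixes cs :: "(nat \<times> nat list) list" and N :: real
  assumes ok: "\<And>m w. (m, w) \<in> set cs \<Longrightarrow> word_ok pre w" and N: "0 < N"
    and weight: "\<And>x. b \<le> x \<Longrightarrow> N / real x \<le> (\<Sum>(m, w)\<leftarrow>cs. real m / real (slot (length w) x))"
    and bound: "(\<Sum>(m, w)\<leftarrow>cs. real m * (real (num_holes pre w) + 1 / 4 -
        (\<Sum>c\<leftarrow>idle pre w. 1 / real (slot (length w) c)))) <
      N * (13 / 10 - (\<Sum>c\<leftarrow>pre. 1 / real c))"
  shows "coverable pre b"
  unfolding coverable_def
proof (intro allI impI)
  fix rest
  assume rest: "\<forall>x\<in>set rest. b \<le> x" and sum: "13 / 10 \<le> (\<Sum>x\<leftarrow>pre @ rest. 1 / real x)"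
  let ?s = "\<lambda>w x. 1 / real (slot (length w) x)"
  let ?T = "\<lambda>w. real (num_holes pre w) + 1 / 4 - (\<Sum>c\<leftarrow>idle pre w. ?s w c)"
  show "covers ((!) (pre @ rest)) {..<length (pre @ rest)}"
  proof (rule ccontr)
    assume "\<not> ?thesis"
    then have fail: "(\<Sum>x\<leftarrow>rest. ?s w x) \<le> ?T w" if "(m, w) \<in> set cs" for m w
      using word_criterion[OF ok[OF that], of rest] by fastforce
    have "N * (13 / 10 - (\<Sum>c\<leftarrow>pre. 1 / real c)) \<le> N * (\<Sum>x\<leftarrow>rest. 1 / real x)"
      using sum N by (intro mult_left_mono) auto
    also have "\<dots> = (\<Sum>x\<leftarrow>rest. N / real x)"
      by (simp flip: sum_list_const_mult)
    also have "\<dots> \<le> (\<Sum>x\<leftarrow>rest. \<Sum>(m, w)\<leftarrow>cs. real m * ?s w x)"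
      using weight rest by (intro sum_list_mono) auto
    also have "\<dots> = (\<Sum>(m, w)\<leftarrow>cs. real m * (\<Sum>x\<leftarrow>rest. ?s w x))"
      by (induction rest) (simp_all add: sum_list_addf case_prod_unfold distrib_left)
    also have "\<dots> \<le> (\<Sum>(m, w)\<leftarrow>cs. real m * ?T w)"
      using fail by (intro sum_list_mono) (auto intro!: mult_left_mono)
    finally show False
      using bound by simp
  qed
qed

section \<open>Integer certificates and their soundness\<close>

text \<open>The factor 192 clears most of the denominators; where a division is not exact, rounding down is
  on the safe side. Passing from \<open>\<lceil>x / 2\<rceil>\<close> to \<open>x\<close> at most halves the weight and at least doubles
  \<open>x - 1\<close>, so the bound with \<open>x - 1\<close> on one octave implies it for all larger \<open>x\<close>.\<close>

definition weight :: "(nat \<times> nat list) list \<Rightarrow> nat \<Rightarrow> nat" where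
  "weight cs x = (\<Sum>(m, w)\<leftarrow>cs. m * (192 div slot (length w) x))"

text \<open>\<open>B\<close> separates the periods tested one by one from the octave that settles
  all larger ones. The last conjunct is the assumption \<open>bound\<close> of
  \<open>coverable_weights\<close> for \<open>N / 192\<close>, multiplied by
  \<open>1920 * prod_list pre\<close>, with the credit of idle periods rounded down and negative
  terms moved across to stay within the naturals.\<close>

definition leaf_ok :: "nat list \<Rightarrow> nat \<Rightarrow> nat \<Rightarrow> nat \<Rightarrow> (nat \<times> nat list) list \<Rightarrow> bool" where
  "leaf_ok pre b N B cs \<longleftrightarrow> b \<le> B \<and> 0 < N \<and>
     list_all (\<lambda>(m, w). word_ok pre w) cs \<and>
     list_all (\<lambda>x. N \<le> weight cs x * x) [b..<B] \<and>
     list_all (\<lambda>x. N \<le> weight cs x * (x - 1)) [B..<2 * B] \<and>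
     10 * prod_list pre * (\<Sum>(m, w)\<leftarrow>cs. m * (192 * num_holes pre w + 48)) +
       10 * N * (\<Sum>c\<leftarrow>pre. prod_list pre div c) <
     13 * N * prod_list pre +
       10 * prod_list pre * (\<Sum>(m, w)\<leftarrow>cs. m * (\<Sum>c\<leftarrow>idle pre w. 192 div slot (length w) c))"

datatype cert = Leaf nat nat "(nat \<times> nat list) list" | Branch cert cert

text \<open>New periods enter at the front, so in the words of a certificate position 0 is the
  period added last.\<close>

fun check :: "nat list \<Rightarrow> nat \<Rightarrow> cert \<Rightarrow> bool" where
  "check pre b (Leaf N B cs) \<longleftrightarrow> leaf_ok pre b N B cs"
| "check pre b (Branch l r) \<longleftrightarrow> check (b # pre) b l \<and> check pre (Suc b) r"

lemma real_sum_list: "real (\<Sum>x\<leftarrow>xs. f x) = (\<Sum>x\<leftarrow>xs. real (f x))"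
  by (induction xs) simp_all

lemma leaf_sound:
  assumes leaf: "leaf_ok pre b N B cs" and pos: "0 < b" "\<And>c. c \<in> set pre \<Longrightarrow> 0 < c"
  shows "coverable pre b"
proof (rule coverable_weights[where N = "real N / 192" and cs = cs])
  \<comment> \<open>The exact real weight, of which \<open>weight\<close> is a lower bound after
    scaling by 192.\<close>
  define W where "W x = (\<Sum>(m, w)\<leftarrow>cs. real m * (1 / real (slot (length w) x)))" for x
  have ok: "word_ok pre w" if "(m, w) \<in> set cs" for m w
    using leaf that unfolding leaf_ok_def list_all_iff by auto
  show "word_ok pre w" if "(m, w) \<in> set cs" for m w
    by (rule ok[OF that])
  have bB: "b \<le> B" and low: "\<And>x. b \<le> x \<Longrightarrow> x < B \<Longrightarrow> N \<le> weight cs x * x"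
    and high: "\<And>x. B \<le> x \<Longrightarrow> x < 2 * B \<Longrightarrow> N \<le> weight cs x * (x - 1)"
    using leaf unfolding leaf_ok_def list_all_iff by auto
  have div_le: "real (192 div k) \<le> 192 * (1 / real k)" for k
    using of_nat_div_le_of_nat[of 192 k, where 'a = real] by simp
  have weight_le: "real (weight cs x) \<le> 192 * W x" for x
  proof -
    have "real (weight cs x) = (\<Sum>(m, w)\<leftarrow>cs. real m * real (192 div slot (length w) x))"
      unfolding weight_def real_sum_list by (simp add: comp_def case_prod_unfold)
    also have "\<dots> \<le> (\<Sum>(m, w)\<leftarrow>cs. real m * (192 * (1 / real (slot (length w) x))))"
      by (intro sum_list_mono) (auto intro!: mult_left_mono simp del: times_divide_eq_right
        intro: div_le)
    also have "\<dots> = 192 * W x"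
      unfolding W_def sum_list_const_mult[symmetric]
      by (simp add: case_prod_unfold mult.commute)
    finally show ?thesis .
  qed
  have W_half: "W ((x + 1) div 2) \<le> 2 * W x" for x
    unfolding W_def sum_list_const_mult[symmetric]
  proof (rule sum_list_mono)
    fix p assume p: "p \<in> set cs"
    obtain m w where mw: "p = (m, w)"
      by (cases p)
    have "real (slot (length w) x) \<le> 2 * real (slot (length w) ((x + 1) div 2))"
      using slot_double[of "length w" x] ok[of m w] p mw by (auto simp: word_ok_def)
    then have "1 / real (slot (length w) ((x + 1) div 2)) \<le> 2 * (1 / real (slot (length w) x))"
      using slot_pos[of "length w" x] slot_pos[of "length w" "(x + 1) div 2"]
      by (simp add: field_simps)
    then have "real m * (1 / real (slot (length w) ((x + 1) div 2))) \<le>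
        real m * (2 * (1 / real (slot (length w) x)))"
      by (rule mult_left_mono) simp
    then show "(case p of (m, w) \<Rightarrow> real m * (1 / real (slot (length w) ((x + 1) div 2)))) \<le>
        2 * (case p of (m, w) \<Rightarrow> real m * (1 / real (slot (length w) x)))"
      by (simp add: mw mult.commute)
  qed
  have W_nonneg: "0 \<le> W x" for x
    unfolding W_def by (intro sum_list_nonneg) auto
  have tail: "real N \<le> 192 * W x * (real x - 1)" if "B \<le> x" for x
    using that
  proof (induction x rule: less_induct)
    case (less x)
    show ?case
    proof (cases "x < 2 * B")
      case True
      have "real N \<le> real (weight cs x * (x - 1))"
        using high[OF less.prems True] by (rule of_nat_mono)
      also have "\<dots> = real (weight cs x) * (real x - 1)"
        using less.prems bB pos(1) by (simp add: of_nat_diff)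
      also have "\<dots> \<le> 192 * W x * (real x - 1)"
        using less.prems bB pos(1) by (intro mult_right_mono weight_le) auto
      finally show ?thesis .
    next
      case False
      define y where "y = (x + 1) div 2"
      have y: "B \<le> y" "y < x"
        using False bB pos(1) by (auto simp: y_def)
      \<comment> \<open>Here \<open>x - 1\<close> matters: for odd \<open>x\<close> the rounded half
        \<open>y\<close> exceeds \<open>x / 2\<close>, but \<open>y - 1\<close> never exceeds
        \<open>(x - 1) / 2\<close>.\<close>
      have y1: "0 \<le> real y - 1" "real y - 1 \<le> (real x - 1) / 2"
        using y(1) bB pos(1) of_nat_div_le_of_nat[of "x + 1" 2, where 'a = real]
        unfolding y_def by (simp_all add: field_simps)
      have "real N \<le> 192 * W y * (real y - 1)"
        using less.IH y by blast
      also have "\<dots> \<le> 192 * (2 * W x) * ((real x - 1) / 2)"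
        using W_half[of x] y1 W_nonneg by (intro mult_mono) (auto simp: y_def)
      finally show ?thesis
        by simp
    qed
  qed
  show "real N / 192 / real x \<le> (\<Sum>(m, w)\<leftarrow>cs. real m / real (slot (length w) x))"
    if x: "b \<le> x" for x
  proof -
    have x0: "0 < real x"
      using x pos(1) by simp
    have "real N \<le> 192 * W x * real x"
    proof (cases "x < B")
      case True
      have "real N \<le> real (weight cs x * x)"
        using low[OF x True] by (rule of_nat_mono)
      also have "\<dots> \<le> 192 * W x * real x"
        using mult_right_mono[OF weight_le] x0 by simp
      finally show ?thesis .
    next
      case False
      then have "real N \<le> 192 * W x * (real x - 1)"
        using tail by simp
      also have "\<dots> \<le> 192 * W x * real x"
        using W_nonneg by (intro mult_left_mono) auto
      finally show ?thesis .
    qed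
    then have "real N / 192 / real x \<le> W x"
      using x0 by (simp add: field_simps)
    then show ?thesis
      unfolding W_def by simp
  qed
  define L where "L = prod_list pre"
  define H where "H = (\<Sum>(m, w)\<leftarrow>cs. m * (192 * num_holes pre w + 48))"
  define C where "C = (\<Sum>(m, w)\<leftarrow>cs. m * (\<Sum>c\<leftarrow>idle pre w. 192 div slot (length w) c))"
  define S where "S = (\<Sum>c\<leftarrow>pre. 1 / real c)"
  have L0: "0 < L"
    using pos(2) unfolding L_def by (metis gr0I not_gr_zero prod_list_zero_iff)
  \<comment> \<open>Each \<open>c\<close> divides the product \<open>L\<close>, so this division is
    exact.\<close>
  have "real (L div c) = real L * (1 / real c)" if "c \<in> set pre" for c
    using that unfolding L_def by (simp add: real_of_nat_div prod_list_dvd)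
  then have LS: "real (\<Sum>c\<leftarrow>pre. L div c) = real L * S"
    unfolding S_def real_sum_list sum_list_const_mult[symmetric]
    by (intro arg_cong[where f = sum_list] map_cong) auto
  have key: "10 * L * H + 10 * N * (\<Sum>c\<leftarrow>pre. L div c) < 13 * N * L + 10 * L * C"
    using leaf unfolding leaf_ok_def L_def H_def C_def by blast
  have "real (10 * L * H + 10 * N * (\<Sum>c\<leftarrow>pre. L div c)) < real (13 * N * L + 10 * L * C)"
    using key by (rule of_nat_less_iff[THEN iffD2])
  then have "real L * (10 * real H + 10 * real N * S) < real L * (13 * real N + 10 * real C)"
    by (simp only: of_nat_add of_nat_mult LS of_nat_numeral) (simp add: algebra_simps)
  then have "10 * real H + 10 * real N * S < 13 * real N + 10 * real C"
    using L0 mult_less_cancel_left_pos[of "real L"] by simp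
  then have less: "real H - real C < real N * (13 / 10 - S)"
    by (simp add: algebra_simps)
  define T where "T w = real (num_holes pre w) + 1 / 4 -
    (\<Sum>c\<leftarrow>idle pre w. 1 / real (slot (length w) c))" for w
  \<comment> \<open>Rounding down understates what the idle periods contribute, so the integer
    inequality implies the real one.\<close>
  have credit: "real (\<Sum>c\<leftarrow>idle pre w. 192 div slot (length w) c) \<le>
      192 * (\<Sum>c\<leftarrow>idle pre w. 1 / real (slot (length w) c))" for w
    unfolding real_sum_list sum_list_const_mult[symmetric]
    by (intro sum_list_mono div_le)
  have "192 * (\<Sum>(m, w)\<leftarrow>cs. real m * T w) \<le> real H - real C"
  proof -
    have "192 * (\<Sum>(m, w)\<leftarrow>cs. real m * T w) = (\<Sum>(m, w)\<leftarrow>cs. real m * (192 * T w))"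
      unfolding sum_list_const_mult[symmetric]
      by (intro arg_cong[where f = sum_list] map_cong) auto
    also have "\<dots> \<le> (\<Sum>(m, w)\<leftarrow>cs. real m * (real (192 * num_holes pre w + 48) -
        real (\<Sum>c\<leftarrow>idle pre w. 192 div slot (length w) c)))"
    proof (rule sum_list_mono, clarify)
      fix m w
      show "real m * (192 * T w) \<le> real m * (real (192 * num_holes pre w + 48) -
        real (\<Sum>c\<leftarrow>idle pre w. 192 div slot (length w) c))"
        using credit[of w] by (intro mult_left_mono) (auto simp: T_def)
    qed
    also have "\<dots> = real H - real C"
      unfolding H_def C_def
      by (simp add: real_sum_list case_prod_unfold right_diff_distrib sum_list_subtractf)
    finally show ?thesis .
  qed
  then show "(\<Sum>(m, w)\<leftarrow>cs. real m * (real (num_holes pre w) + 1 / 4 -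
        (\<Sum>c\<leftarrow>idle pre w. 1 / real (slot (length w) c)))) <
      real N / 192 * (13 / 10 - (\<Sum>c\<leftarrow>pre. 1 / real c))"
    using less unfolding T_def[symmetric] S_def[symmetric] by simp
  show "0 < real N / 192"
    using leaf by (simp add: leaf_ok_def)
qed

lemma check_sound:
  "check pre b t \<Longrightarrow> 0 < b \<Longrightarrow> \<forall>c\<in>set pre. 0 < c \<Longrightarrow> coverable pre b"
proof (induction pre b t rule: check.induct)
  case (1 pre b N B cs)
  then show ?case using leaf_sound[of pre b N B cs] by simp
next
  case (2 pre b l r)
  then show ?case using coverable_branch[of b pre] by simp
qed


section \<open>The explicit certificate\<close>

text \<open>The number 9 exceeds the length of every prefix that occurs, so it denotes a hole.\<close>

definition holes :: "nat \<Rightarrow> nat list" where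
  "holes d = replicate d 9"

text \<open>The multipliers are rounded optimal solutions of linear programs.\<close>

definition certificate :: cert where
  "certificate =
  (Branch
   (Branch
    (Leaf 1920 6 [(2, holes 2), (3, [1,0,1,0])])
    (Branch
     (Branch
      (Leaf 1728 6 [(2, [2,9,2,9]), (1, [2,1,0,2,1,0])])
      (Branch
       (Leaf 2304 6 [(3, [2,1,2,0,2,1,2,0])])
       (Branch
        (Branch
         (Leaf 1024 6 [(4, holes 2)])
         (Leaf 3072 10 [(4, [2,9,2,9]), (1, [2,1,2,9,2,9])]))
        (Leaf 2016 10 [(2, [1,9,1,9]), (1, [1,0,1,9,1,0,9])]))))
     (Leaf 1344 10 [(1, [0,9,0,9]), (1, [0,9,0,9,0,9])])))
   (Branch
    (Branch
     (Leaf 1920 6 [(5, holes 3)])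
     (Branch
      (Branch
       (Leaf 5664 12 [(9, holes 2), (1, [2,9,9,2,9,9]), (1, [2,1,0,2,9,1,0,9]),
         (1, [2,1,0,2,9,1,2,0,9])])
       (Branch
        (Branch
         (Leaf 1728 6 [(1, [3,9,9,3,9,9]), (1, [3,2,1,3,0,2,3,1,9,0])])
         (Leaf 57600 12 [(14, [2,9,9,2,9,9]), (7, [2,9,9,2,9,9,9]), (12, [2,1,9,2,9,1,9,9]),
           (7, [2,1,9,2,9,1,2,9,9]), (5, [2,1,0,2,9,1,2,0,9,9]), (4, [2,1,0,2,9,1,2,0,9,2,1,9,9]),
           (1, [2,1,0,2,9,1,2,0,9,2,1,9,9,9])]))
        (Leaf 9152 15 [(4, holes 4), (2, [1,9,9,1,9,9]), (2, [1,0,9,1,9,0,9,9]),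
          (1, [1,0,9,1,9,0,1,9,9]), (1, [1,0,9,1,9,0,1,9,9,9])])))
      (Leaf 58560 15 [(32, holes 3), (24, [0,9,9,0,9,9]), (11, [0,9,9,0,9,9,9]),
        (10, [0,9,9,0,9,9,0,9,9])])))
    (Branch
     (Branch
      (Leaf 37888 12 [(27, holes 2), (11, holes 4), (13, holes 5), (6, [1,0,9,9,1,0,9,9]),
        (6, [1,0,9,9,1,0,9,9,9])])
      (Branch
       (Branch
        (Leaf 192192 10 [(232, holes 2), (141, holes 5), (9, holes 6),
          (10, [2,1,0,9,2,9,1,0,9,9,9])])
        (Branch
         (Branch
          (Leaf 4032 6 [(10, holes 2), (1, [3,2,9,1,3,0,2,9,3,1,9,0])])
          (Branch
           (Leaf 96432 18 [(179, holes 2), (2, holes 7), (1, [3,9,9,9,3,9,9,9,9]),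
             (10, [3,2,9,9,3,9,2,9,9,9]), (8, [3,2,9,1,3,9,2,9,3,1,9,9]),
             (3, [3,2,1,9,3,9,2,9,3,1,9,9,9]), (3, [3,2,1,0,3,9,2,9,1,3,0,2,9,3,1,9,9,9])])
           (Leaf 4992 18 [(3, holes 5), (1, [2,9,9,9,2,9,9,9]), (1, [2,1,9,0,2,9,1,9,2,0,9,9])])))
         (Branch
          (Branch
           (Leaf 38880 20 [(30, holes 4), (3, [3,9,9,9,3,9,9,9]), (4, [3,9,9,9,3,9,9,9,9]),
             (4, [3,2,9,9,3,9,2,9,9,9]), (1, [3,2,1,0,3,9,2,9,3,1,0,9,9,9]),
             (2, [3,2,1,0,3,9,2,9,3,1,0,2,3,9,9,9,9])])
           (Leaf 192192 18 [(90, holes 5), (11, holes 7), (28, [2,9,9,9,2,9,9,9]),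
             (8, [2,1,9,9,2,9,1,9,9,9]), (18, [2,1,9,9,2,9,1,9,9,9,9]),
             (13, [2,1,9,9,2,9,1,9,2,9,9,9]), (8, [2,1,9,9,2,9,1,9,2,9,9,9,9])]))
          (Leaf 14336 18 [(7, holes 5), (2, [1,9,9,9,1,9,9,9]), (2, [1,0,9,9,1,9,0,9,9,9,9]),
            (1, [1,0,9,9,1,9,0,9,1,9,9,9]), (1, [1,0,9,9,1,9,0,9,1,9,9,9,9])]))))
       (Branch
        (Branch
         (Leaf 56832 10 [(114, holes 2), (7, [2,1,9,0,2,9,9,1,2,0,9,9]),
           (3, [2,1,0,9,2,9,9,1,2,0,9,9,9]), (4, [2,1,9,0,2,9,9,1,2,0,9,9,2,1,9,0,9,9])])
         (Leaf 382976 18 [(146, holes 4), (102, holes 5), (78, [1,9,9,9,1,9,9,9]),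
           (39, [1,9,9,9,1,9,9,9,9]), (39, [1,0,9,9,1,9,9,0,1,9,9,9]),
           (5, [1,0,9,9,1,9,9,0,1,9,9,9,9])]))
        (Leaf 58432 18 [(18, holes 4), (17, holes 5), (13, [0,9,9,9,0,9,9,9]),
          (7, [0,9,9,9,0,9,9,9,9]), (3, [0,9,9,9,0,9,9,9,9,9,9]), (2, [0,9,9,9,0,9,9,9,0,9,9,9]),
          (1, [0,9,9,9,0,9,9,9,0,9,9,9,9])]))))
     (Branch
      (Branch
       (Branch
        (Leaf 1728 8 [(1, holes 3), (2, holes 5)])
        (Leaf 5759824 15 [(3429, holes 2), (643, holes 3), (1763, holes 5), (643, holes 6),
          (1071, holes 7), (779, [1,0,9,9,9,1,0,9,9,9]), (161, [1,0,9,9,9,1,0,9,9,9,9])]))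
       (Branch
        (Branch
         (Leaf 26880 20 [(24, holes 2), (16, holes 3), (5, holes 7), (1, [2,9,9,9,9,2,9,9,9,9]),
           (3, [2,1,0,9,9,2,9,1,0,9,9,9,9])])
         (Branch
          (Branch
           (Leaf 58752 18 [(22, holes 2), (31, holes 3), (11, holes 7), (5, holes 8),
             (7, [3,9,9,9,9,3,9,9,9,9]), (4, [3,2,1,0,9,3,9,2,9,1,0,9,9,9]),
             (1, [3,2,1,0,9,3,9,2,9,1,3,0,9,9,9])])
           (Branch
            (Branch
             (Leaf 5600 15 [(5, holes 3), (1, [4,9,9,9,9,4,9,9,9,9]),
               (1, [4,3,2,1,0,4,9,3,9,2,4,1,0,9,9,9])])
             (Leaf 1918464 24 [(1288, holes 3), (392, holes 7), (189, [3,9,9,9,9,3,9,9,9,9]),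
               (139, [3,2,9,9,9,3,9,2,9,9,9,9,9]), (70, [3,2,1,9,9,3,9,2,9,1,3,9,9,9,9]),
               (87, [3,2,1,0,9,3,9,2,9,1,3,0,9,9,9,9])]))
            (Leaf 382464 18 [(197, holes 3), (98, holes 7), (46, [2,9,9,9,9,2,9,9,9,9]),
              (22, [2,9,9,9,9,2,9,9,9,9,9]), (11, [2,1,0,9,9,2,9,1,9,0,9,9,9,9]),
              (17, [2,1,0,9,9,2,9,1,9,0,2,9,9,9,9]), (11, [2,1,0,9,9,2,9,1,9,0,2,9,9,9,9,9])])))
          (Branch
           (Branch
            (Leaf 383040 20 [(297, holes 3), (51, holes 8), (32, [3,9,9,9,9,3,9,9,9,9]),
              (37, [3,2,9,9,9,3,9,2,9,9,9,9,9]), (33, [3,2,1,9,0,3,9,2,9,9,1,3,0,9,9,9])])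
            (Leaf 39104 24 [(17, holes 3), (10, holes 5), (3, holes 6), (5, holes 7),
              (2, [2,9,9,9,9,2,9,9,9,9]), (4, [2,1,9,9,9,2,9,1,9,9,9,9,9]),
              (2, [2,1,0,9,9,2,9,1,9,9,0,2,9,9,9,9])]))
           (Leaf 40032 18 [(11, holes 3), (8, holes 5), (9, holes 6), (6, holes 7),
             (3, [1,9,9,9,9,1,9,9,9,9]), (4, [1,0,9,9,9,1,9,0,9,9,9,9,9]),
             (1, [1,0,9,9,9,1,9,0,9,9,1,9,9,9,9,9])]))))
        (Branch
         (Branch
          (Branch
           (Leaf 1922304 15 [(1227, holes 3), (123, holes 5), (556, holes 7), (278, holes 8),
             (18, holes 9), (141, [3,9,9,9,9,3,9,9,9,9]), (66, [3,2,1,0,9,3,9,9,2,1,3,0,9,9,9])])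
           (Branch
            (Leaf 192000 30 [(33, holes 3), (83, holes 4), (55, holes 5), (10, holes 7),
              (11, holes 9), (5, [3,9,9,9,9,3,9,9,9,9]), (9, [3,9,9,9,9,3,9,9,9,9,9]),
              (8, [3,2,1,9,9,3,9,9,2,1,3,9,9,9,9]), (7, [3,2,1,0,9,3,9,9,2,1,3,0,9,9,9,9,9])])
            (Leaf 39424 18 [(18, holes 3), (10, holes 7), (1, holes 9),
              (4, [2,9,9,9,9,2,9,9,9,9]), (3, [2,9,9,9,9,2,9,9,9,9,9]),
              (1, [2,1,0,9,9,2,9,9,1,0,9,9,9,9]), (2, [2,1,0,9,9,2,9,9,1,0,2,9,9,9,9]),
              (1, [2,1,0,9,9,2,9,9,1,0,2,9,9,9,9,9])])))
          (Branch
           (Leaf 384192 30 [(32, holes 3), (122, holes 4), (145, holes 5), (10, holes 7),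
             (15, holes 8), (27, holes 9), (30, [2,9,9,9,9,2,9,9,9,9,9]),
             (19, [2,1,9,9,9,2,9,9,1,9,9,9,9,9]), (10, [2,1,0,9,9,2,9,9,1,9,2,0,9,9,9,9,9])])
           (Leaf 56848 24 [(13, holes 3), (24, holes 5), (12, holes 7), (2, holes 9),
             (5, [1,9,9,9,9,1,9,9,9,9,9]), (1, [1,9,9,9,9,1,9,9,9,9,9,9,9]),
             (1, [1,0,9,9,9,1,9,9,0,9,1,9,9,9,9]), (2, [1,0,9,9,9,1,9,9,0,9,1,9,9,9,9,9])])))
         (Branch
          (Leaf 36000 30 [(3, holes 3), (12, holes 4), (15, holes 5), (1, holes 8),
            (5, [1,9,9,9,9,1,9,9,9,9,9]), (2, [1,9,9,9,9,1,9,9,9,9,9,9,9]),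
            (1, [1,0,9,9,9,1,9,9,9,0,1,9,9,9,9,9,9])])
          (Leaf 38688 18 [(10, holes 5), (8, holes 6), (6, holes 7), (1, holes 8), (3, holes 9),
            (2, [0,9,9,9,9,0,9,9,9,9]), (3, [0,9,9,9,9,0,9,9,9,9,9]),
            (2, [0,9,9,9,9,0,9,9,9,9,9,9,9])])))))
      (Branch
       (Branch
        (Leaf 192384 20 [(192, holes 2), (91, holes 3), (8, holes 6), (26, holes 7), (6, holes 8),
          (7, holes 9), (3, [1,0,9,9,9,9,1,0,9,9,9,9]), (19, [1,0,9,9,9,9,1,0,9,9,9,9,9])])
        (Branch
         (Branch
          (Leaf 95424 18 [(51, holes 3), (18, holes 4), (23, holes 7), (8, holes 8), (3, holes 9),
            (9, holes 10), (5, [2,1,0,9,9,9,2,9,1,0,9,9,9,9])])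
          (Branch
           (Branch
            (Leaf 94608 30 [(43, holes 3), (41, holes 4), (12, holes 8), (4, holes 9),
              (9, holes 10), (5, [3,9,9,9,9,9,3,9,9,9,9,9,9]),
              (3, [3,2,1,0,9,9,3,9,2,9,1,0,9,9,9,9,9])])
            (Branch
             (Leaf 37728 30 [(25, holes 3), (9, holes 4), (1, holes 5), (6, holes 7),
               (3, holes 10), (2, [3,9,9,9,9,9,3,9,9,9,9,9,9]),
               (2, [3,2,1,9,0,9,3,9,2,9,1,9,3,0,9,9,9,9])])
             (Leaf 383424 30 [(70, holes 3), (121, holes 4), (67, holes 5), (63, holes 7),
               (14, holes 10), (18, holes 11), (6, [2,9,9,9,9,9,2,9,9,9,9,9]),
               (20, [2,9,9,9,9,9,2,9,9,9,9,9,9]), (13, [2,1,0,9,9,9,2,9,1,9,0,9,9,9,9,9,9]),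
               (6, [2,1,0,9,9,9,2,9,1,9,0,9,2,9,9,9,9,9])])))
           (Branch
            (Leaf 57728 30 [(40, holes 3), (5, holes 4), (8, holes 5), (9, holes 7),
              (3, holes 10), (3, [2,1,9,9,9,9,2,9,1,9,9,9,9,9]),
              (1, [2,1,9,9,9,9,2,9,1,9,9,9,9,9,9]), (3, [2,1,0,9,9,9,2,9,1,9,9,0,2,9,9,9,9,9])])
            (Leaf 96432 30 [(25, holes 4), (19, holes 5), (13, holes 6), (16, holes 7),
              (3, holes 10), (4, [1,9,9,9,9,9,1,9,9,9,9,9]), (6, [1,9,9,9,9,9,1,9,9,9,9,9,9]),
              (1, [1,0,9,9,9,9,1,9,0,9,9,9,9,9,9]), (3, [1,0,9,9,9,9,1,9,0,9,9,9,9,9,9,9,9]),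
              (1, [1,0,9,9,9,9,1,9,0,9,9,9,1,9,9,9,9,9])]))))
         (Branch
          (Branch
           (Leaf 383616 30 [(169, holes 3), (137, holes 4), (37, holes 5), (37, holes 7),
             (10, holes 8), (16, holes 9), (24, holes 10), (27, [2,9,9,9,9,9,2,9,9,9,9,9,9]),
             (11, [2,1,0,9,9,9,2,9,9,1,0,9,9,9,9,9,9])])
           (Branch
            (Leaf 17200 30 [(12, holes 3), (2, holes 4), (3, holes 5), (2, holes 7),
              (1, holes 10), (1, [2,9,9,9,9,9,2,9,9,9,9,9,9]),
              (1, [2,1,0,9,9,9,2,9,9,1,9,0,2,9,9,9,9,9])])
            (Leaf 59488 30 [(15, holes 4), (11, holes 5), (7, holes 6), (9, holes 7),
              (1, holes 8), (2, holes 10), (3, [1,9,9,9,9,9,1,9,9,9,9,9]),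
              (4, [1,9,9,9,9,9,1,9,9,9,9,9,9]), (2, [1,0,9,9,9,9,1,9,9,0,9,9,9,9,9,9,9]),
              (1, [1,0,9,9,9,9,1,9,9,0,9,9,1,9,9,9,9,9])])))
          (Leaf 190944 20 [(15, holes 4), (39, holes 5), (43, holes 6), (27, holes 7),
            (22, holes 9), (5, holes 10), (11, holes 11), (11, [0,9,9,9,9,9,0,9,9,9,9,9,9]),
            (2, [0,9,9,9,9,9,0,9,9,9,9,9,9,9,9])]))))
       (Branch
        (Branch
         (Leaf 37376 18 [(7, holes 3), (13, holes 4), (8, holes 5), (9, holes 7), (4, holes 9),
           (1, holes 10), (2, holes 11)])
         (Leaf 383488 20 [(65, holes 3), (134, holes 4), (79, holes 5), (55, holes 7),
           (44, holes 9), (10, holes 10), (23, holes 11), (17, holes 13)]))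
        (Leaf 95808 20 [(15, holes 3), (31, holes 4), (23, holes 5), (11, holes 7), (1, holes 8),
          (11, holes 9), (8, holes 11), (5, holes 13)])))))))"

text \<open>A finite computation. It starts with no known period and with 2, the least period
  possible once period 1 is excluded.\<close>

lemma certificate_ok: "check [] 2 certificate"
  by code_simp

theorem theorem3p5:
  fixes a :: "nat list"
  assumes "covering_instance a"
    and "(\<Sum>j<length a. 1 / real (a ! j)) \<ge> 13 / 10"
  shows "schedulable a"
proof (rule covers_imp_schedulable)
  have pos: "0 < x" if "x \<in> set a" for x
    using assms(1) that by (simp add: covering_instance_def)
  show "covers ((!) a) {..<length a}"
  \<comment> \<open>A job of period 1 can be assigned to every day; all other instances fall under
    the certificate.\<close>
  proof (cases "1 \<in> set a")
    case True
    then obtain i where "i < length a" "a ! i = 1"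
      by (auto simp: in_set_conv_nth)
    then show ?thesis by (auto intro: covers_single)
  next
    case False
    have "2 \<le> x" if "x \<in> set a" for x
      using pos[OF that] False that by (cases "x = 1") auto
    moreover have "13 / 10 \<le> (\<Sum>x\<leftarrow>a. 1 / real x)"
      using assms(2) by (simp add: sum_list_sum_nth atLeast0LessThan)
    moreover have "coverable [] 2"
      using check_sound[OF certificate_ok] by simp
    ultimately show ?thesis
      by (simp add: coverable_def)
  qed
qed

end
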